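(* Let $d\ge 2$ be an integer. In ${\mathbb F}_{4^d}^{2d}$ let $V$ be the $2d$-dimensional ${\mathbb F}_4$-subspace consisting of the vectors $$\boldsymbol v(a,b)=(a,b,a^4,b^4,\dots,a^{4^{d-1}},b^{4^{d-1}}),\quad a,b\in{\mathbb F}_{4^d},$$ so that ${\rm PG}(V)\cong{\rm PG}(2d-1,4)$, and for $(a,b)\ne(0,0)$ let $P(a,b)$ be the point of ${\rm PG}(V)$ spanned by $\boldsymbol v(a,b)$. Then the set $$\mathcal V_1=\{P(x,x^{-2})\mid x\in{\mathbb F}_{4^d}\setminus\{0\}\}$$ is a complete $4$-general set of ${\rm PG}(2d-1,4)$ of size $\frac{4^d-1}{3}$.
   Context: A $4$-general set of ${\rm PG}(n,q)$ is a set of points spanning ${\rm PG}(n,q)$ such that no four of its points lie on a plane; it is complete if it is not contained in a strictly larger $4$-general set. *)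

theory Defs
  imports Complex_Main "HOL-Library.Cardinality" "HOL-Library.Function_Algebras"
begin

text \<open>
  Projective geometry of a subspace \<open>V\<close> of a vector space with scalar multiplication
  \<open>scl\<close>: points are the subspaces of
  \<open>V\<close> of vector-space dimension 1, planes those of vector-space dimension 3, and a point
  lies on a plane if it is contained in it.  If \<open>V\<close> has dimension \<open>n + 1\<close> over a
  field with \<open>q\<close> elements, this is \<open>PG(n, q)\<close>.
\<close>

definition proj_points ::
  "('k::field \<Rightarrow> 'b::ab_group_add \<Rightarrow> 'b) \<Rightarrow> 'b set \<Rightarrow> 'b set set" where
  "proj_points scl V = {p. module.subspace scl p \<and> p \<subseteq> V \<and> vector_space.dim scl p = 1}"

definition proj_planes ::
  "('k::field \<Rightarrow> 'b::ab_group_add \<Rightarrow> 'b) \<Rightarrow> 'b set \<Rightarrow> 'b set set" where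
  "proj_planes scl V = {E. module.subspace scl E \<and> E \<subseteq> V \<and> vector_space.dim scl E = 3}"

definition four_general ::
  "('k::field \<Rightarrow> 'b::ab_group_add \<Rightarrow> 'b) \<Rightarrow> 'b set \<Rightarrow> 'b set set \<Rightarrow> bool" where
  "four_general scl V S \<longleftrightarrow>
     S \<subseteq> proj_points scl V \<and> module.span scl (\<Union>S) = V \<and>
     \<not> (\<exists>T\<subseteq>S. card T = 4 \<and> (\<exists>E\<in>proj_planes scl V. \<forall>p\<in>T. p \<subseteq> E))"

definition complete_four_general ::
  "('k::field \<Rightarrow> 'b::ab_group_add \<Rightarrow> 'b) \<Rightarrow> 'b set \<Rightarrow> 'b set set \<Rightarrow> bool" where
  "complete_four_general scl V S \<longleftrightarrow>
     four_general scl V S \<and> \<not> (\<exists>S'. four_general scl V S' \<and> S \<subset> S')"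

text \<open>
  Vectors of \<open>F\<^sup>m\<close> are functions \<open>nat \<Rightarrow> 'a\<close> vanishing outside \<open>{..<m}\<close>.
  The field with 4 elements is a type \<open>'k\<close> together with a field embedding
  \<open>\<phi> :: 'k \<Rightarrow> 'a\<close>; restriction of scalars along \<open>\<phi>\<close> makes \<open>F\<^sup>m\<close> a vector space
  over \<open>'k\<close>.
\<close>

definition emb_scale :: "('k \<Rightarrow> 'a) \<Rightarrow> 'k \<Rightarrow> (nat \<Rightarrow> 'a) \<Rightarrow> nat \<Rightarrow> 'a::field" where
  "emb_scale \<phi> c u = (\<lambda>i. \<phi> c * u i)"

lemma vector_space_emb_scale:
  fixes \<phi> :: "'k::field \<Rightarrow> 'a::field"
  assumes "\<phi> 1 = 1" "\<And>x y. \<phi> (x + y) = \<phi> x + \<phi> y" "\<And>x y. \<phi> (x * y) = \<phi> x * \<phi> y"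
  shows "vector_space (emb_scale \<phi>)"
  by unfold_locales (auto simp: emb_scale_def assms algebra_simps fun_eq_iff)

definition vec_ab :: "nat \<Rightarrow> 'a \<Rightarrow> 'a \<Rightarrow> nat \<Rightarrow> 'a::field" where
  "vec_ab d a b =
     (\<lambda>i. if i < 2 * d then (if even i then a else b) ^ (4 ^ (i div 2)) else 0)"

definition space_V :: "nat \<Rightarrow> (nat \<Rightarrow> 'a::field) set" where
  "space_V d = {vec_ab d a b | a b. True}"

definition point_P :: "('k::field \<Rightarrow> 'a::field) \<Rightarrow> nat \<Rightarrow> 'a \<Rightarrow> 'a \<Rightarrow> (nat \<Rightarrow> 'a) set" where
  "point_P \<phi> d a b = module.span (emb_scale \<phi>) {vec_ab d a b}"

definition set_V1 :: "('k::field \<Rightarrow> 'a::field) \<Rightarrow> nat \<Rightarrow> (nat \<Rightarrow> 'a) set set" where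
  "set_V1 \<phi> d = {point_P \<phi> d x (x powi (-2)) | x. x \<noteq> 0}"

end

theory Submission
  imports Defs "HOL-Computational_Algebra.Primes" "HOL-Library.FuncSet"
begin

text \<open>
  Scaling by the cube roots of unity of \<open>F\<^sub>4\<close> permutes the vectors \<open>v(x, x\<^sup>-\<^sup>2)\<close>, so a
  dependency between points of \<open>V\<^sub>1\<close> can be written as \<open>\<Sum> y\<^sub>i = 0 = \<Sum> y\<^sub>i\<^sup>-\<^sup>2\<close>, that is
  \<open>\<Sum> y\<^sub>i = 0 = \<Sum> y\<^sub>i\<^sup>-\<^sup>1\<close>; with at most four nonzero summands, two of them then agree up to a cube root of
  unity.  Conversely every vector \<open>v(a, c\<^sup>2)\<close> with \<open>(a, c) \<noteq> (0, 0)\<close> and \<open>a c \<noteq> 1\<close> is a sum of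
  three of these vectors, which gives both the spanning property and completeness.  After
  normalising \<open>a = 1\<close> this asks for an \<open>s\<close> such that some \<open>\<alpha> s + \<beta> / s + \<gamma>\<close> has the
  form \<open>z\<^sup>2 + z\<close>.  Instead of bounding a Kloosterman sum, one uses that such elements form a
  subgroup of index 2.
\<close>

section \<open>Finite fields of characteristic 2\<close>

lemma add_self_CHAR_2:
  fixes x :: "'a::ring_1"
  assumes "CHAR('a) = 2"
  shows "x + x = 0"
  using minus_CHAR_2[OF assms, of x x] by simp

lemma add_eq_0_iff_CHAR_2:
  fixes x y :: "'a::ring_1"
  assumes "CHAR('a) = 2"
  shows "x + y = 0 \<longleftrightarrow> x = y"
  using uminus_CHAR_2[OF assms, of y] eq_neg_iff_add_eq_0[of x y] by simp

lemma power2_add_CHAR_2: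
  fixes x y :: "'a::comm_ring_1"
  assumes "CHAR('a) = 2"
  shows "(x + y)\<^sup>2 = x\<^sup>2 + y\<^sup>2"
  by (rule freshmans_dream) (simp_all only: assms two_is_prime_nat)

lemma power_4_power_add_CHAR_2:
  fixes x y :: "'a::comm_ring_1"
  assumes "CHAR('a) = 2"
  shows "(x + y) ^ 4 ^ n = x ^ 4 ^ n + y ^ 4 ^ n"
proof (rule freshmans_dream')
  show "4 ^ n = CHAR('a) ^ (2 * n)" by (simp add: assms power_mult)
qed (simp only: assms two_is_prime_nat)

text \<open>Translation by 1 permutes the field, so comparing the sums of all elements gives
  \<open>of_nat CARD('a) = 0\<close>. Hence a power of 2 vanishes in the field, and so does
  2.\<close>

lemma CHAR_eq_2:
  assumes "CARD('a::{field,finite}) = 2 ^ n"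
  shows "CHAR('a) = 2"
proof -
  have "(\<Sum>x::'a\<in>UNIV. x + 1) = (\<Sum>x\<in>UNIV. x)"
    by (rule sum.reindex_bij_witness[of _ "\<lambda>x. x - 1" "\<lambda>x. x + 1"]) auto
  hence "(of_nat CARD('a) :: 'a) = 0" by (simp add: sum.distrib)
  hence "(2::'a) = 0" by (simp add: assms)
  hence "CHAR('a) dvd 2" using of_nat_eq_0_iff_char_dvd[of 2, where ?'a='a] by simp
  thus ?thesis by (metis CHAR_not_1' One_nat_def prime_nat_iff two_is_prime_nat)
qed

text \<open>Multiplication by \<open>x\<close> permutes the nonzero elements and so fixes their
  product.\<close>

lemma power_CARD_minus_1_eq_1:
  fixes x :: "'a::{field,finite}"
  assumes "x \<noteq> 0"
  shows "x ^ (CARD('a) - 1) = 1"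
proof -
  have "x ^ (CARD('a) - 1) * \<Prod>(UNIV - {0}) = (\<Prod>y\<in>UNIV - {0}. x * y)"
    by (simp add: prod.distrib)
  also have "\<dots> = \<Prod>(UNIV - {0})"
    by (rule prod.reindex_bij_witness[of _ "\<lambda>y. y / x" "\<lambda>y. x * y"]) (use assms in auto)
  finally show ?thesis by simp
qed

text \<open>Squaring is additive with trivial kernel, hence injective, hence surjective on a finite
  field.\<close>

lemma square_surj_CHAR_2:
  fixes b :: "'a::{field,finite}"
  assumes "CHAR('a) = 2"
  obtains c where "c\<^sup>2 = b"
proof -
  have "inj (\<lambda>x::'a. x\<^sup>2)"
    by (rule injI) (metis add_eq_0_iff_CHAR_2[OF assms] power2_add_CHAR_2[OF assms] power_eq_0_iff)
  hence "surj (\<lambda>x::'a. x\<^sup>2)" by (rule finite_UNIV_inj_surj[OF finite])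
  thus ?thesis using that by (metis surjD)
qed

section \<open>The Artin-Schreier subgroup of index 2\<close>

text \<open>The map is additive with kernel {0, 1}, so its fibres {z, z + 1} partition the field
  into pairs.\<close>

lemma card_artin_schreier_image:
  assumes "CHAR('a::{field,finite}) = 2"
  shows "2 * card (range (\<lambda>z::'a. z\<^sup>2 + z)) = CARD('a)"
proof -
  let ?f = "\<lambda>z::'a. z\<^sup>2 + z"
  have fib: "?f -` {?f z} = {z, z + 1}" for z
  proof -
    have "?f y = ?f z \<longleftrightarrow> (y + z) * (y + z + 1) = 0" for y
    proof -
      have "?f y = ?f z \<longleftrightarrow> ?f y + ?f z = 0" by (simp add: add_eq_0_iff_CHAR_2[OF assms])
      also have "?f y + ?f z = (y + z)\<^sup>2 + (y + z)" by (simp add: power2_add_CHAR_2[OF assms])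
      also have "\<dots> = (y + z) * (y + z + 1)" by (simp add: power2_eq_square algebra_simps)
      finally show ?thesis .
    qed
    moreover have "y + z + 1 = 0 \<longleftrightarrow> y = z + 1" for y
      using add_eq_0_iff_CHAR_2[OF assms, of y "z + 1"] by (simp add: add.assoc)
    ultimately show ?thesis by (auto simp: add_eq_0_iff_CHAR_2[OF assms])
  qed
  have "2 * card ((\<lambda>y. ?f -` {y}) ` range ?f) = card (\<Union>((\<lambda>y. ?f -` {y}) ` range ?f))"
    by (rule card_partition) (auto simp: fib[simplified])
  moreover have "inj_on (\<lambda>y. ?f -` {y}) (range ?f)" by (rule inj_onI) auto
  moreover have "\<Union>((\<lambda>y. ?f -` {y}) ` range ?f) = UNIV" by auto
  ultimately show ?thesis by (simp add: card_image)
qed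

text \<open>The image \<open>A\<close> contains half of the field and is disjoint from its translate
  by \<open>u\<close>, so the translate is the whole complement of \<open>A\<close>. Thus
  \<open>v = u + x\<close> with \<open>x\<close> in \<open>A\<close>, and
  \<open>u + v = x\<close>.\<close>

lemma artin_schreier_index_2:
  fixes u v :: "'a::{field,finite}"
  assumes char: "CHAR('a) = 2"
    and "u \<notin> range (\<lambda>z. z\<^sup>2 + z)" "v \<notin> range (\<lambda>z. z\<^sup>2 + z)"
  shows "u + v \<in> range (\<lambda>z. z\<^sup>2 + z)"
proof -
  define A where "A = range (\<lambda>z::'a. z\<^sup>2 + z)"
  have add: "x + y \<in> A" if "x \<in> A" "y \<in> A" for x y
  proof -
    from that obtain z w where "x = z\<^sup>2 + z" "y = w\<^sup>2 + w" by (auto simp: A_def)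
    hence "x + y = (z + w)\<^sup>2 + (z + w)" by (simp add: power2_add_CHAR_2[OF char])
    thus ?thesis by (auto simp: A_def)
  qed
  have cancel: "x + (x + y) = y" for x y :: 'a
    by (simp add: add_self_CHAR_2[OF char] flip: add.assoc)
  have "u + x \<notin> A" if "x \<in> A" for x
  proof
    assume "u + x \<in> A"
    hence "x + (x + u) \<in> A" using add[OF that] by (simp only: add.commute[of u x])
    thus False using assms(2) by (simp add: cancel A_def)
  qed
  hence "A \<inter> (+) u ` A = {}" by auto
  hence "card (A \<union> (+) u ` A) = card A + card A"
    by (simp add: card_Un_disjoint card_image)
  hence "A \<union> (+) u ` A = UNIV"
    using card_artin_schreier_image[OF char] by (intro card_eq_UNIV_imp_eq_UNIV) (auto simp: A_def)
  hence "v \<in> (+) u ` A" using assms(3) by (auto simp: A_def)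
  then obtain x where "x \<in> A" "v = u + x" by blast
  thus ?thesis by (simp add: cancel A_def)
qed

section \<open>Prescribing the sum of three elements and the sum of their inverses\<close>

text \<open>Adding the equations of two roots \<open>t\<close> and \<open>r\<close> gives (t + r)(t
  + r + 1) = 0, so a field without such a \<open>t\<close> has at most the elements 0, 1, r, r + 1.
  The element found serves to split 0 as 1 + t + (1 + t) while keeping 1 + 1/t + 1/(1 + t)
  nonzero.\<close>

lemma ex_not_root_cyclotomic_3:
  assumes "CHAR('a) = 2" "CARD('a) > 4"
  obtains t :: "'a::{field,finite}" where "t \<noteq> 0" "t \<noteq> 1" "t\<^sup>2 + t + 1 \<noteq> 0"
proof (rule ccontr)
  note th = that
  assume "\<not> thesis"
  hence *: "t\<^sup>2 + t + 1 = 0" if "t \<noteq> 0" "t \<noteq> 1" for t :: 'a using that th by blast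
  have "\<exists>r. (UNIV :: 'a set) \<subseteq> {0, 1, r, r + 1}"
  proof (cases "\<exists>r::'a. r \<noteq> 0 \<and> r \<noteq> 1")
    case True
    then obtain r :: 'a where r: "r \<noteq> 0" "r \<noteq> 1" by blast
    have "t \<in> {0, 1, r, r + 1}" for t
    proof (cases "t = 0 \<or> t = 1")
      case False
      hence "(t\<^sup>2 + t + 1) + (r\<^sup>2 + r + 1) = 0" using * r by simp
      moreover have "(t\<^sup>2 + t + 1) + (r\<^sup>2 + r + 1) = (t + r)\<^sup>2 + (t + r) + (1 + 1)"
        unfolding power2_add_CHAR_2[OF assms(1)] by (simp add: algebra_simps)
      ultimately have "(t + r) * (t + (r + 1)) = 0"
        unfolding add_self_CHAR_2[OF assms(1)] by (simp add: power2_eq_square algebra_simps)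
      thus ?thesis by (auto simp: add_eq_0_iff_CHAR_2[OF assms(1)])
    qed auto
    thus ?thesis by blast
  qed auto
  then obtain r :: 'a where "UNIV \<subseteq> {0, 1, r, r + 1}" by blast
  hence "CARD('a) \<le> card {0, 1, r, r + 1}" by (rule card_mono[rotated]) simp
  also have "\<dots> \<le> 4" by (simp add: card_insert_if)
  finally show False using assms(2) by simp
qed

text \<open>
  If no such \<open>s\<close> existed, the value \<open>\<alpha> s + \<beta> / s + \<gamma>\<close> of the left-hand side would
  lie outside the index 2 subgroup \<open>{z\<^sup>2 + z}\<close> for almost all \<open>s\<close>.  Adding the values at
  \<open>s\<close>, \<open>t s\<close> and \<open>(1 + t) s\<close> cancels the linear term and leaves an injective
  function of \<open>s\<close>, which takes too many values outside the subgroup.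
\<close>

lemma ex_kloosterman_in_artin_schreier_image:
  fixes w :: "'a::{field,finite}"
  assumes char: "CHAR('a) = 2" and card: "CARD('a) \<ge> 16" and w: "w \<noteq> 0" "w \<noteq> 1"
  obtains s z where "s \<noteq> 0" "s \<noteq> 1" "s \<noteq> w"
    "(s + 1) * (s + w) / (s * (1 + w)\<^sup>2) = z\<^sup>2 + z"
proof (rule ccontr)
  note th = that
  assume contr: "\<not> thesis"
  define A where "A = range (\<lambda>z::'a. z\<^sup>2 + z)"
  define f where "f s = (s + 1) * (s + w) / (s * (1 + w)\<^sup>2)" for s
  have notin: "f s \<notin> A" if "s \<noteq> 0" "s \<noteq> 1" "s \<noteq> w" for s
    using contr that th unfolding A_def f_def by auto
  have w1: "1 + w \<noteq> 0" using w by (simp add: add_eq_0_iff_CHAR_2[OF char])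
  obtain t :: 'a where t: "t \<noteq> 0" "t \<noteq> 1" "t\<^sup>2 + t + 1 \<noteq> 0"
    using ex_not_root_cyclotomic_3[OF char] card by auto
  have t1: "1 + t \<noteq> 0" using t by (simp add: add_eq_0_iff_CHAR_2[OF char])
  \<comment> \<open>These are the constant term and the coefficient of 1/s in the sum of
    \<open>f\<close> over \<open>s\<close>, \<open>t * s\<close> and \<open>(1 + t) * s\<close>. The
    factor of \<open>\<beta>\<close> that involves \<open>t\<close> is 1 + 1/t + 1/(1 + t).\<close>
  define \<gamma> where "\<gamma> = 1 / (1 + w)"
  define \<beta> where "\<beta> = w / (1 + w)\<^sup>2 * ((t\<^sup>2 + t + 1) / (t * (1 + t)))"
  have \<beta>: "\<beta> \<noteq> 0" using t t1 w w1 by (simp add: \<beta>_def)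
  have f_split: "f s = s / (1 + w)\<^sup>2 + w / (1 + w)\<^sup>2 * (1 / s) + \<gamma>" if "s \<noteq> 0" for s
  proof -
    define e where "e = 1 + w"
    have num: "(s + 1) * (s + w) = s * s + w + s * e" by (simp add: e_def algebra_simps)
    have "e \<noteq> 0" using w1 by (simp add: e_def)
    thus ?thesis unfolding f_def \<gamma>_def num e_def[symmetric]
      using that by (simp add: add_divide_distrib power2_eq_square mult_ac)
  qed
  have f_sum3: "f x + f y + f z
      = (x + y + z) / (1 + w)\<^sup>2 + w / (1 + w)\<^sup>2 * (1 / x + 1 / y + 1 / z) + (\<gamma> + \<gamma> + \<gamma>)"
    if "x \<noteq> 0" "y \<noteq> 0" "z \<noteq> 0" for x y z
    unfolding f_split[OF that(1)] f_split[OF that(2)] f_split[OF that(3)]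
    by (simp only: add_divide_distrib distrib_left add_ac)
  have f_sum: "f s + f (t * s) + f ((1 + t) * s) = \<beta> / s + \<gamma>" if "s \<noteq> 0" for s
  proof -
    have "f s + f (t * s) + f ((1 + t) * s)
        = (s + t * s + (1 + t) * s) / (1 + w)\<^sup>2
          + w / (1 + w)\<^sup>2 * (1 / s + 1 / (t * s) + 1 / ((1 + t) * s)) + (\<gamma> + \<gamma> + \<gamma>)"
      by (rule f_sum3) (use that t t1 in simp_all)
    also have "s + t * s + (1 + t) * s = 0"
      using add_self_CHAR_2[OF char, of "(1 + t) * s"] by (simp add: algebra_simps)
    also have "\<gamma> + \<gamma> + \<gamma> = \<gamma>" by (simp add: add_self_CHAR_2[OF char])
    also have "1 / s + 1 / (t * s) + 1 / ((1 + t) * s)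
        = (t * (1 + t) + (1 + t) + t) / (t * (1 + t)) / s"
      using that t t1 by (simp add: divide_simps) (simp add: algebra_simps)
    also have "t * (1 + t) + (1 + t) + t = t\<^sup>2 + t + 1 + (t + t)"
      by (simp add: algebra_simps power2_eq_square)
    also have "\<dots> = t\<^sup>2 + t + 1" by (simp only: add_self_CHAR_2[OF char]) simp
    finally show ?thesis by (simp add: \<beta>_def)
  qed
  \<comment> \<open>\<open>E\<close> collects the \<open>s\<close> for which \<open>s\<close>,
    \<open>t * s\<close> or \<open>(1 + t) * s\<close> is one of the excluded arguments 0, 1,
    \<open>w\<close>.\<close>
  define E where "E = {0, 1, w, 1 / t, w / t, 1 / (1 + t), w / (1 + t)}"
  have "\<beta> / s + \<gamma> \<in> - A" if "s \<notin> E" for s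
  proof -
    have "f (k * s) \<notin> A" if "k \<noteq> 0" "s \<notin> {0, 1 / k, w / k}" for k
      using that by (intro notin) (auto simp: field_simps)
    from this[of 1] this[of t] this[of "1 + t"] \<open>s \<notin> E\<close> t t1
    have nA: "f s \<notin> A" "f (t * s) \<notin> A" "f ((1 + t) * s) \<notin> A"
      by (simp_all add: E_def)
    \<comment> \<open>Two values outside a subgroup of index 2 add up to an element inside; a third
      outside value leads out again.\<close>
    have "f s + f (t * s) \<in> A"
      using artin_schreier_index_2[OF char nA(1,2)[unfolded A_def]] unfolding A_def .
    then obtain z where z: "f s + f (t * s) = z\<^sup>2 + z" by (auto simp: A_def)
    have "f s + f (t * s) + f ((1 + t) * s) \<notin> A"
    proof
      assume "f s + f (t * s) + f ((1 + t) * s) \<in> A"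
      then obtain y where "f s + f (t * s) + f ((1 + t) * s) = y\<^sup>2 + y" by (auto simp: A_def)
      hence "z\<^sup>2 + z + f ((1 + t) * s) = y\<^sup>2 + y" by (simp add: z)
      hence "f ((1 + t) * s) = (y\<^sup>2 + y) - (z\<^sup>2 + z)" by (simp add: algebra_simps)
      also have "\<dots> = (y\<^sup>2 + y) + (z\<^sup>2 + z)" by (simp add: minus_CHAR_2[OF char])
      also have "\<dots> = (y + z)\<^sup>2 + (y + z)" by (simp add: power2_add_CHAR_2[OF char])
      finally have "f ((1 + t) * s) \<in> A" by (auto simp: A_def)
      thus False using nA(3) by blast
    qed
    thus ?thesis using that by (simp add: f_sum E_def)
  qed
  hence "(\<lambda>s. \<beta> / s + \<gamma>) ` (- E) \<subseteq> - A" by blast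
  moreover have "inj_on (\<lambda>s. \<beta> / s + \<gamma>) (- E)"
    using \<beta> by (auto intro!: inj_onI simp: E_def field_simps)
  ultimately have "card (- E) \<le> card (- A)" by (meson card_inj_on_le finite)
  hence "2 * (CARD('a) - card E) \<le> 2 * (CARD('a) - card A)" by (simp add: Compl_eq_Diff_UNIV card_Diff_subset)
  moreover have "card E \<le> 7"
    using card_length[of "[0, 1, w, 1 / t, w / t, 1 / (1 + t), w / (1 + t)]"] by (simp add: E_def)
  \<comment> \<open>With q elements in the field, 2(q - 7) \<le> 2(q - q/2) = q would force q \<le>
    14.\<close>
  ultimately show False using card card_artin_schreier_image[OF char] by (simp add: A_def)
qed

text \<open>
  For given \<open>x\<close>, the other two summands are the roots of
  \<open>T\<^sup>2 + (1 + x) T + x (1 + x) / (1 + w x)\<close>.  With \<open>s = (1 + w x) / (1 + x)\<close>, scaling the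
  unknown by \<open>m = 1 + x\<close> turns this into the equation of the previous lemma.
\<close>

lemma ex_three_sum_normalized:
  fixes w :: "'a::{field,finite}"
  assumes char: "CHAR('a) = 2" and card: "CARD('a) \<ge> 16" and w: "w \<noteq> 0" "w \<noteq> 1"
  obtains x y z where "x \<noteq> 0" "y \<noteq> 0" "z \<noteq> 0" "x + y + z = 1"
    "inverse x + inverse y + inverse z = w"
proof -
  obtain s r where s: "s \<noteq> 0" "s \<noteq> 1" "s \<noteq> w"
    and r: "(s + 1) * (s + w) / (s * (1 + w)\<^sup>2) = r\<^sup>2 + r"
    using ex_kloosterman_in_artin_schreier_image[OF assms] .
  have nz: "1 + w \<noteq> 0" "1 + s \<noteq> 0" "s + w \<noteq> 0"
    using s w by (simp_all add: add_eq_0_iff_CHAR_2[OF char])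
  \<comment> \<open>Solving s = (1 + w x) / (1 + x) for \<open>x\<close> gives this value, and then
    \<open>m\<close> is 1 + x.\<close>
  define x where "x = (1 + s) / (s + w)"
  define m where "m = (1 + w) / (s + w)"
  have m: "m \<noteq> 0" using nz by (simp add: m_def)
  have xm: "x + m = 1"
  proof -
    have "x + m = (s + w + (1 + 1)) / (s + w)"
      using nz by (simp add: x_def m_def algebra_simps flip: add_divide_distrib)
    thus ?thesis using nz by (simp only: add_self_CHAR_2[OF char]) simp
  qed
  \<comment> \<open>\<open>x / s\<close> is the constant term of the quadratic for the other two
    summands; its roots will be \<open>r * m\<close> and \<open>(r + 1) * m\<close>, with sum
    \<open>m\<close>.\<close>
  have prod: "r * (r + 1) * m\<^sup>2 = x / s"
  proof -
    have "r * (r + 1) = r\<^sup>2 + r" by (simp add: power2_eq_square algebra_simps)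
    hence r: "r * (r + 1) = (s + 1) * (s + w) / (s * (1 + w)\<^sup>2)" by (simp only: r)
    show ?thesis unfolding r x_def m_def
      using s nz by (simp add: divide_simps power2_eq_square add.commute)
  qed
  have x: "x \<noteq> 0" using nz by (simp add: x_def)
  hence r0: "r \<noteq> 0" "r + 1 \<noteq> 0" using prod s by auto
  have mr: "r * m + (r + 1) * m = m"
  proof -
    have "r * m + (r + 1) * m = (r + r) * m + m" by (simp add: algebra_simps)
    thus ?thesis by (simp add: add_self_CHAR_2[OF char])
  qed
  have "inverse (r * m) + inverse ((r + 1) * m) = (r * m + (r + 1) * m) / (r * (r + 1) * m\<^sup>2)"
    using r0 m by (simp add: divide_simps power2_eq_square) (simp add: algebra_simps)
  also have "\<dots> = m * s / x" using s x by (simp add: mr prod)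
  finally have "inverse x + (inverse (r * m) + inverse ((r + 1) * m)) = (1 + m * s) / x"
    using x by (simp add: field_simps)
  also have "\<dots> = w"
  proof -
    have "1 + m * s = (w * (1 + s) + (s + s)) / (s + w)"
      using nz by (simp add: m_def divide_simps) (simp add: algebra_simps)
    also have "\<dots> = w * x" by (simp add: x_def add_self_CHAR_2[OF char])
    finally show ?thesis using x by simp
  qed
  finally have "inverse x + inverse (r * m) + inverse ((r + 1) * m) = w" by (simp add: add.assoc)
  moreover have "x + r * m + (r + 1) * m = 1" using mr xm by (simp add: add.assoc)
  ultimately show ?thesis using that[of x "r * m" "(r + 1) * m"] x m r0 by simp
qed

text \<open>The elements x, t x, (1 + t) x add up to 0, and their inverses to (t^2 + t + 1) / (t (1
  + t) x); \<open>x\<close> is chosen to make this equal to \<open>c\<close>.\<close>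

lemma ex_three_sum_zero:
  fixes c :: "'a::{field,finite}"
  assumes char: "CHAR('a) = 2" and card: "CARD('a) \<ge> 16" and c: "c \<noteq> 0"
  obtains x y z where "x \<noteq> 0" "y \<noteq> 0" "z \<noteq> 0" "x + y + z = 0"
    "inverse x + inverse y + inverse z = c"
proof -
  obtain t :: 'a where t: "t \<noteq> 0" "t \<noteq> 1" "t\<^sup>2 + t + 1 \<noteq> 0"
    using ex_not_root_cyclotomic_3[OF char] card by auto
  have t1: "1 + t \<noteq> 0" using t by (simp add: add_eq_0_iff_CHAR_2[OF char])
  define x where "x = (t\<^sup>2 + t + 1) / (t * (1 + t) * c)"
  have x: "x \<noteq> 0" using t t1 c by (simp add: x_def)
  have "x + t * x + (1 + t) * x = 0"
    using add_self_CHAR_2[OF char, of "(1 + t) * x"] by (simp add: algebra_simps)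
  moreover have "inverse x + inverse (t * x) + inverse ((1 + t) * x) = c"
  proof -
    have "inverse x + inverse (t * x) + inverse ((1 + t) * x)
        = (t * (1 + t) + (1 + t) + t) / (t * (1 + t)) / x"
      using x t t1 by (simp add: divide_simps) (simp add: algebra_simps)
    also have "t * (1 + t) + (1 + t) + t = t\<^sup>2 + t + 1 + (t + t)"
      by (simp add: algebra_simps power2_eq_square)
    also have "\<dots> = t\<^sup>2 + t + 1" by (simp only: add_self_CHAR_2[OF char]) simp
    also have "\<dots> / (t * (1 + t)) / x = c" using t t1 c by (simp add: x_def)
    finally show ?thesis .
  qed
  ultimately show ?thesis using that[of x "t * x" "(1 + t) * x"] x t t1 by simp
qed

text \<open>For nonzero \<open>a\<close> and \<open>c\<close>, scaling the summands by
  \<open>a\<close> reduces to sum 1 and inverse sum \<open>a * c\<close>. If \<open>a\<close> or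
  \<open>c\<close> vanishes, the previous lemma applies, for \<open>c = 0\<close> after exchanging
  the summands with their inverses.\<close>

lemma ex_three_sum:
  fixes a c :: "'a::{field,finite}"
  assumes char: "CHAR('a) = 2" and card: "CARD('a) \<ge> 16"
    and "(a, c) \<noteq> (0, 0)" "a * c \<noteq> 1"
  obtains x y z where "x \<noteq> 0" "y \<noteq> 0" "z \<noteq> 0" "x + y + z = a"
    "inverse x + inverse y + inverse z = c"
proof (cases "a = 0")
  case True
  with assms(3) have c: "c \<noteq> 0" by simp
  obtain x y z where "x \<noteq> 0" "y \<noteq> 0" "z \<noteq> 0" "x + y + z = 0"
    "inverse x + inverse y + inverse z = c"
    using ex_three_sum_zero[OF char card c] .
  thus ?thesis using that True by blast
next
  case a: False
  show ?thesis
  proof (cases "c = 0")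
    case True
    obtain x y z where "x \<noteq> 0" "y \<noteq> 0" "z \<noteq> 0" "x + y + z = 0"
      "inverse x + inverse y + inverse z = a"
      using ex_three_sum_zero[OF char card a] .
    thus ?thesis using that[of "inverse x" "inverse y" "inverse z"] True by simp
  next
    case False
    then obtain x y z where *: "x \<noteq> 0" "y \<noteq> 0" "z \<noteq> 0" "x + y + z = 1"
      "inverse x + inverse y + inverse z = a * c"
      using ex_three_sum_normalized[OF char card, of "a * c"] a assms(4) by auto
    have "a * x + a * y + a * z = a" 
      using *(4) by (simp flip: distrib_left)
    moreover have "inverse (a * x) + inverse (a * y) + inverse (a * z) = c"
    proof -
      have "inverse (a * x) + inverse (a * y) + inverse (a * z)
          = inverse a * (inverse x + inverse y + inverse z)"
        by (simp add: distrib_left)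
      thus ?thesis using a by (simp add: *(5))
    qed
    ultimately show ?thesis using that[of "a * x" "a * y" "a * z"] *(1-3) a by simp
  qed
qed

section \<open>Vanishing sums of at most four elements and of their inverses\<close>

text \<open>Eliminating c = a + b from the second equation leaves (a + b)^2 = a b, that is a^2 + a b
  + b^2 = 0; multiplying by a + b gives a^3 + b^3 = 0.\<close>

lemma three_sum_eq_0_imp_cube_eq:
  fixes a b c :: "'a::field"
  assumes char: "CHAR('a) = 2"
    and nz: "a \<noteq> 0" "b \<noteq> 0" "c \<noteq> 0"
    and sum: "a + b + c = 0" and inv: "inverse a + inverse b + inverse c = 0"
  shows "a ^ 3 = b ^ 3"
proof -
  have c: "c = a + b" using add_eq_0_iff_CHAR_2[OF char, of "a + b" c] sum by simp
  have "inverse a + inverse b = inverse c"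
    using add_eq_0_iff_CHAR_2[OF char, of "inverse a + inverse b" "inverse c"] inv by simp
  hence "(a + b) * (a + b) = a * b" using nz by (simp add: c field_simps)
  hence "(a + b) * ((a + b) * (a + b)) = (a + b) * (a * b)" by simp
  hence "a ^ 3 + b ^ 3 + (a * b * (a + b) + a * b * (a + b)) = 0"
    by (simp add: algebra_simps power3_eq_cube)
  thus ?thesis unfolding add_self_CHAR_2[OF char] by (simp add: add_eq_0_iff_CHAR_2[OF char])
qed

text \<open>The pairs a, b and c, e have equal sums and equal sums of inverses. If the common sum is
  0, then a = b; otherwise the products agree too, so both pairs are the roots of one
  quadratic.\<close>

lemma four_sum_eq_0_imp_eq:
  fixes a b c e :: "'a::field"
  assumes char: "CHAR('a) = 2"
    and nz: "a \<noteq> 0" "b \<noteq> 0" "c \<noteq> 0" "e \<noteq> 0"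
    and sum: "a + b + c + e = 0"
    and inv: "inverse a + inverse b + inverse c + inverse e = 0"
  shows "a = b \<or> a = c \<or> a = e"
proof -
  have s: "a + b = c + e"
    using add_eq_0_iff_CHAR_2[OF char, of "a + b" "c + e"] sum by (simp add: add.assoc)
  have "inverse a + inverse b = inverse c + inverse e"
    using add_eq_0_iff_CHAR_2[OF char, of "inverse a + inverse b" "inverse c + inverse e"] inv
    by (simp add: add.assoc)
  moreover have "inverse x + inverse y = (x + y) / (x * y)" if "x \<noteq> 0" "y \<noteq> 0" for x y :: 'a
    using that by (simp add: field_simps)
  ultimately have "(c + e) / (a * b) = (c + e) / (c * e)" using nz s by metis
  hence "c + e = 0 \<or> a * b = c * e" using nz by (auto simp: divide_simps)
  moreover have "a = b" if "c + e = 0" using that s add_eq_0_iff_CHAR_2[OF char, of a b] by simp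
  moreover have "(a - c) * (a - e) = 0" if "a * b = c * e"
  proof -
    have "(a - c) * (a - e) = a * a - a * (c + e) + c * e" by (simp add: algebra_simps)
    also have "\<dots> = 0" unfolding s[symmetric] that[symmetric] by (simp add: algebra_simps)
    finally show ?thesis .
  qed
  ultimately show ?thesis by auto
qed

text \<open>
  In the next two lemmas the convention \<open>inverse 0 = 0\<close> lets the sums have fewer nonzero terms.
\<close>

lemma three_sum_eq_0_imp_all_0:
  fixes a b c :: "'a::field"
  assumes char: "CHAR('a) = 2"
    and sum: "a + b + c = 0" and inv: "inverse a + inverse b + inverse c = 0"
    and ne: "a ^ 3 = b ^ 3 \<Longrightarrow> a = 0" "a ^ 3 = c ^ 3 \<Longrightarrow> a = 0" "b ^ 3 = c ^ 3 \<Longrightarrow> b = 0"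
  shows "a = 0 \<and> b = 0 \<and> c = 0"
proof -
  have eq: "x = y" if "x + y = 0" for x y :: 'a
    using that by (simp add: add_eq_0_iff_CHAR_2[OF char])
  \<comment> \<open>If all three were nonzero, \<open>a\<close> and \<open>b\<close> would have
    equal cubes, which \<open>ne\<close> forbids. Once one element is 0, the other two are
    equal.\<close>
  consider "a = 0" | "b = 0" | "c = 0"
    using three_sum_eq_0_imp_cube_eq[OF char _ _ _ sum inv] ne by blast
  thus ?thesis
  proof cases
    case 1
    with sum eq[of b c] have "b = c" by simp
    with 1 ne(3) show ?thesis by simp
  next
    case 2
    with sum eq[of a c] have "a = c" by simp
    with 2 ne(2) show ?thesis by simp
  next
    case 3
    with sum eq[of a b] have "a = b" by simp
    with 3 ne(1) show ?thesis by simp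
  qed
qed

lemma four_sum_eq_0_imp_all_0:
  fixes a b c e :: "'a::field"
  assumes char: "CHAR('a) = 2"
    and sum: "a + b + c + e = 0"
    and inv: "inverse a + inverse b + inverse c + inverse e = 0"
    and ne: "a ^ 3 = b ^ 3 \<Longrightarrow> a = 0" "a ^ 3 = c ^ 3 \<Longrightarrow> a = 0" "a ^ 3 = e ^ 3 \<Longrightarrow> a = 0"
      "b ^ 3 = c ^ 3 \<Longrightarrow> b = 0" "b ^ 3 = e ^ 3 \<Longrightarrow> b = 0" "c ^ 3 = e ^ 3 \<Longrightarrow> c = 0"
  shows "a = 0 \<and> b = 0 \<and> c = 0 \<and> e = 0"
proof -
  note three = three_sum_eq_0_imp_all_0[OF char]
  \<comment> \<open>If all four were nonzero, \<open>a\<close> would equal another one, against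
    \<open>ne\<close>. Dropping a zero element leaves the case of three.\<close>
  consider "a = 0" | "b = 0" | "c = 0" | "e = 0"
    using four_sum_eq_0_imp_eq[OF char _ _ _ _ sum inv] ne(1-3) by blast
  thus ?thesis
  proof cases
    case 1
    hence "b + c + e = 0" "inverse b + inverse c + inverse e = 0" using sum inv by simp_all
    from three[OF this ne(4,5,6)] 1 show ?thesis by blast
  next
    case 2
    hence "a + c + e = 0" "inverse a + inverse c + inverse e = 0" using sum inv by simp_all
    from three[OF this ne(2,3,6)] 2 show ?thesis by blast
  next
    case 3
    hence "a + b + e = 0" "inverse a + inverse b + inverse e = 0" using sum inv by simp_all
    from three[OF this ne(1,3,5)] 3 show ?thesis by blast
  next
    case 4
    hence "a + b + c = 0" "inverse a + inverse b + inverse c = 0" using sum inv by simp_all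
    from three[OF this ne(1,2,4)] 4 show ?thesis by blast
  qed
qed

section \<open>Linear algebra over the embedded field with 4 elements\<close>

text \<open>Vectors of the span correspond to their coefficient families on \<open>B\<close>. Taking
  these as extensional functions makes the correspondence injective and the families countable by
  \<open>card_PiE\<close>. This allows a dimension to be read off from a cardinality.\<close>

lemma (in vector_space) card_span_independent:
  assumes "independent B" "finite B"
  shows "card (span B) = CARD('a) ^ card B"
proof -
  define L where "L u = (\<Sum>v\<in>B. scale (u v) v)" for u
  have "L ` (B \<rightarrow>\<^sub>E UNIV) = range L"
  proof (intro equalityI subsetI)
    fix x assume "x \<in> range L"
    then obtain u where "x = L u" by blast
    hence "x = L (restrict u B)" by (simp add: L_def)
    moreover have "restrict u B \<in> B \<rightarrow>\<^sub>E UNIV" by simp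
    ultimately show "x \<in> L ` (B \<rightarrow>\<^sub>E UNIV)" by blast
  qed auto
  hence "span B = L ` (B \<rightarrow>\<^sub>E UNIV)"
    using span_finite[OF assms(2)] by (simp add: L_def [abs_def])
  moreover have "inj_on L (B \<rightarrow>\<^sub>E UNIV)"
  proof (rule inj_onI)
    fix u u' assume u: "u \<in> B \<rightarrow>\<^sub>E UNIV" "u' \<in> B \<rightarrow>\<^sub>E UNIV" and "L u = L u'"
    hence "(\<Sum>v\<in>B. scale (u v - u' v) v) = 0"
      by (simp add: L_def scale_left_diff_distrib sum_subtractf)
    hence "u v - u' v = 0" if "v \<in> B" for v
      using independentD[OF assms(1,2) subset_refl, of "\<lambda>v. u v - u' v"] that by blast
    thus "u = u'" using u by (intro PiE_ext) auto
  qed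
  ultimately show ?thesis by (simp add: card_image card_PiE assms(2))
qed

locale gf4_extension =
  fixes \<phi> :: "'k::{field,finite} \<Rightarrow> 'a::{field,finite}" and d :: nat
  assumes d_ge_2: "d \<ge> 2"
    and CARD_extension: "CARD('a) = 4 ^ d"
    and CARD_base: "CARD('k) = 4"
    and hom_1: "\<phi> 1 = 1"
    and hom_add: "\<And>x y. \<phi> (x + y) = \<phi> x + \<phi> y"
    and hom_mult: "\<And>x y. \<phi> (x * y) = \<phi> x * \<phi> y"
begin

sublocale vector_space "emb_scale \<phi>"
  by (rule vector_space_emb_scale) (rule hom_1 hom_add hom_mult)+

lemma CHAR_extension: "CHAR('a) = 2"
  by (rule CHAR_eq_2[of "2 * d"]) (simp add: CARD_extension power_mult)

lemma CARD_extension_ge: "CARD('a) \<ge> 16"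
  using power_increasing[OF d_ge_2, of "4::nat"] by (simp add: CARD_extension)

lemma hom_0: "\<phi> 0 = 0"
proof -
  have "\<phi> 0 + \<phi> 0 = \<phi> 0 + 0" using hom_add[of 0 0] by (simp only: add_0_right)
  thus ?thesis by (simp only: add_left_cancel)
qed

lemma hom_eq_0_iff: "\<phi> c = 0 \<longleftrightarrow> c = 0"
  using hom_mult[of c "inverse c"] by (cases "c = 0") (auto simp: hom_0 hom_1)

lemma hom_diff: "\<phi> (x - y) = \<phi> x - \<phi> y"
  using hom_add[of "x - y" y] by simp

lemma hom_inj: "\<phi> x = \<phi> y \<longleftrightarrow> x = y"
  using hom_eq_0_iff[of "x - y"] by (simp add: hom_diff)

lemma hom_cube:
  assumes "c \<noteq> 0"
  shows "\<phi> c ^ 3 = 1"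
proof -
  have "c ^ 3 = 1" using power_CARD_minus_1_eq_1[OF assms] by (simp add: CARD_base)
  thus ?thesis by (simp add: power3_eq_cube hom_1 flip: hom_mult)
qed

text \<open>Elements of F_4 satisfy c^4 = c. This makes v(a, b) homogeneous over F_4.\<close>

lemma hom_power_4_power: "\<phi> c ^ 4 ^ i = \<phi> c"
proof (induction i)
  case (Suc i)
  have "\<phi> c ^ 4 = \<phi> c"
    using hom_cube[of c] hom_0 power_add[of "\<phi> c" 1 3] by (cases "c = 0") auto
  thus ?case using Suc by (simp add: power_mult)
qed simp

text \<open>Nonzero elements of F_4 have cube 1, so c^(-2) = c; for 0 the convention
  \<open>inverse 0 = 0\<close> gives the same. Scaling by F_4 therefore respects the form v(x,
  x^(-2)).\<close>

lemma inverse_hom_square: "(inverse (\<phi> c))\<^sup>2 = \<phi> c"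
proof (cases "c = 0")
  case False
  have "(\<phi> c)\<^sup>2 * \<phi> c = 1"
    using hom_cube[OF False] by (simp add: power3_eq_cube power2_eq_square)
  hence "inverse ((\<phi> c)\<^sup>2) = \<phi> c" by (rule inverse_unique)
  thus ?thesis by (simp add: power_inverse)
qed (simp add: hom_0)

text \<open>An element \<open>w\<close> of F_4 other than 0 and 1 has an image \<open>r\<close> with
  r^2 + r + 1 = 0, so X^3 - 1 splits as (X - 1)(X - r)(X - r^2) with all roots in the image of
  \<open>\<phi>\<close>.\<close>

lemma ex_hom_eq_cube_root:
  assumes "\<kappa> ^ 3 = 1"
  obtains c where "c \<noteq> 0" "\<phi> c = \<kappa>"
proof -
  have "\<exists>w::'k. w \<notin> {0, 1}"
  proof (rule ccontr)
    assume "\<not> ?thesis"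
    hence "(UNIV :: 'k set) \<subseteq> {0, 1}" by auto
    hence "CARD('k) \<le> card {0, 1 :: 'k}" by (rule card_mono[rotated]) simp
    thus False by (simp add: CARD_base)
  qed
  then obtain w :: 'k where w: "w \<noteq> 0" "w \<noteq> 1" by blast
  define r where "r = \<phi> w"
  have "r \<noteq> 1" using w hom_inj[of w 1] by (simp add: r_def hom_1)
  moreover have "(r - 1) * (r\<^sup>2 + r + 1) = 0"
    using hom_cube[OF w(1)] by (simp add: r_def algebra_simps power3_eq_cube power2_eq_square)
  ultimately have "r\<^sup>2 + r + 1 = 0" by simp
  hence r: "r\<^sup>2 = - (r + 1)" 
    using eq_neg_iff_add_eq_0[of "r\<^sup>2" "r + 1"] by (simp only: add.assoc)
  have "(\<kappa> - 1) * ((\<kappa> - r) * (\<kappa> - r\<^sup>2)) = \<kappa> ^ 3 - 1"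
  proof -
    have "r * r\<^sup>2 = 1" using hom_cube[OF w(1)] by (simp add: r_def power3_eq_cube power2_eq_square mult.assoc)
    moreover have "(\<kappa> - r) * (\<kappa> - r\<^sup>2) = \<kappa>\<^sup>2 - (r + r\<^sup>2) * \<kappa> + r * r\<^sup>2"
      by (simp add: algebra_simps power2_eq_square)
    moreover have "r + r\<^sup>2 = - 1" by (simp add: r)
    ultimately have "(\<kappa> - r) * (\<kappa> - r\<^sup>2) = \<kappa>\<^sup>2 + \<kappa> + 1"
      by (simp only:) simp
    thus ?thesis by (simp add: algebra_simps power3_eq_cube power2_eq_square)
  qed
  hence "\<kappa> = 1 \<or> \<kappa> = r \<or> \<kappa> = r\<^sup>2" using assms by simp
  moreover have "r\<^sup>2 = \<phi> (w * w)" by (simp add: r_def hom_mult power2_eq_square)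
  ultimately show ?thesis
    using that[of 1] that[of w] that[of "w * w"] w hom_1 by (auto simp: r_def)
qed

section \<open>The space V and its points\<close>

lemma vec_ab_add: "vec_ab d a b + vec_ab d a' b' = vec_ab d (a + a' :: 'a) (b + b')"
  by (auto simp: vec_ab_def fun_eq_iff power_4_power_add_CHAR_2[OF CHAR_extension])

lemma emb_scale_vec_ab: "emb_scale \<phi> c (vec_ab d a b) = vec_ab d (\<phi> c * a) (\<phi> c * b)"
  by (auto simp: vec_ab_def emb_scale_def fun_eq_iff power_mult_distrib hom_power_4_power)

lemma vec_ab_eq_iff: "vec_ab d a b = vec_ab d a' (b' :: 'a) \<longleftrightarrow> a = a' \<and> b = b'"
proof
  assume "vec_ab d a b = vec_ab d a' b'"
  from fun_cong[OF this, of 0] fun_cong[OF this, of 1] d_ge_2 show "a = a' \<and> b = b'"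
    by (simp add: vec_ab_def)
qed simp

lemma vec_ab_0: "vec_ab d 0 (0 :: 'a) = 0"
  by (auto simp: vec_ab_def fun_eq_iff)

lemma vec_ab_in_space_V: "vec_ab d a b \<in> space_V d"
  by (auto simp: space_V_def)

lemma subspace_space_V: "subspace (space_V d)"
proof (rule subspaceI)
  show "0 \<in> (space_V d :: (nat \<Rightarrow> 'a) set)" unfolding space_V_def using vec_ab_0 by force
next
  fix x y :: "nat \<Rightarrow> 'a" assume "x \<in> space_V d" "y \<in> space_V d"
  then obtain a b a' b' where "x = vec_ab d a b" "y = vec_ab d a' b'"
    by (auto simp: space_V_def)
  thus "x + y \<in> space_V d" by (simp add: vec_ab_add vec_ab_in_space_V)
next
  fix c and x :: "nat \<Rightarrow> 'a" assume "x \<in> space_V d"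
  then obtain a b where "x = vec_ab d a b" by (auto simp: space_V_def)
  thus "emb_scale \<phi> c x \<in> space_V d" by (simp add: emb_scale_vec_ab vec_ab_in_space_V)
qed

lemma space_V_eq_image: "space_V d = (\<lambda>(a, b). vec_ab d a (b :: 'a)) ` UNIV"
  by (auto simp: space_V_def)

text \<open>By counting: V has one vector for each pair (a, b), hence 4^(2d) vectors, and a space of
  dimension n over F_4 has 4^n.\<close>

lemma dim_space_V: "dim (space_V d :: (nat \<Rightarrow> 'a) set) = 2 * d"
proof -
  let ?V = "space_V d :: (nat \<Rightarrow> 'a) set"
  have "inj (\<lambda>(a, b). vec_ab d a (b :: 'a))" by (auto intro!: injI simp: vec_ab_eq_iff)
  hence "card ?V = CARD('a \<times> 'a)" unfolding space_V_eq_image by (rule card_image)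
  hence card_V: "card ?V = 4 ^ (2 * d)"
    by (simp add: CARD_extension mult_2 power_add)
  obtain B where B: "B \<subseteq> ?V" "independent B" "?V \<subseteq> span B" "card B = dim ?V"
    using basis_exists .
  have "span B = ?V" using B span_minimal[OF B(1) subspace_space_V] by blast
  moreover have "finite B" using B(1) by (rule finite_subset) (simp add: space_V_eq_image)
  ultimately have "4 ^ dim ?V = (4::nat) ^ (2 * d)"
    using card_span_independent[OF B(2)] by (simp add: card_V CARD_base B(4))
  thus ?thesis by (subst (asm) power_inject_exp) simp_all
qed

lemma dim_span_singleton: "v \<noteq> 0 \<Longrightarrow> dim (span {v}) = 1"
  by (simp add: dim_eq_card_independent)

lemma span_singleton_in_proj_points:
  assumes "v \<in> space_V d" "v \<noteq> 0"
  shows "span {v} \<in> proj_points (emb_scale \<phi>) (space_V d)"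
  using assms span_minimal[OF _ subspace_space_V, of "{v}"] dim_span_singleton[OF assms(2)]
  by (simp add: proj_points_def)

lemma proj_point_eq_span_singleton:
  assumes "p \<in> proj_points (emb_scale \<phi>) (space_V d)"
  obtains a b where "(a, b) \<noteq> (0, 0)" "p = span {vec_ab d a b}"
proof -
  from assms have p: "subspace p" "p \<subseteq> space_V d" "dim p = 1" by (auto simp: proj_points_def)
  obtain B where B: "B \<subseteq> p" "independent B" "p \<subseteq> span B" "card B = dim p"
    using basis_exists .
  then obtain v where v: "B = {v}" using p(3) by (auto simp: card_1_singleton_iff)
  hence p_eq: "p = span {v}" using B span_minimal[OF B(1) p(1)] by blast
  from v B p obtain a b where ab: "v = vec_ab d a b" by (auto simp: space_V_def)
  have "v \<noteq> 0" using B(2) v by simp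
  hence "(a, b) \<noteq> (0, 0)" using ab vec_ab_0 by auto
  thus ?thesis using that p_eq ab by simp
qed

section \<open>The points of V_1 and their number\<close>

text \<open>Using \<open>inverse\<close> extends v(x, x^(-2)) to all \<open>x\<close> with
  \<open>curve 0 = 0\<close>, so that multiples by the scalar 0 need no separate treatment.\<close>

definition curve :: "'a \<Rightarrow> nat \<Rightarrow> 'a" where
  "curve x = vec_ab d x ((inverse x)\<^sup>2)"

lemma curve_eq_iff: "curve x = curve y \<longleftrightarrow> x = y"
  by (auto simp: curve_def vec_ab_eq_iff)

lemma curve_eq_0_iff: "curve x = 0 \<longleftrightarrow> x = 0"
  using curve_eq_iff[of x 0] by (simp add: curve_def vec_ab_0)

lemma curve_in_space_V: "curve x \<in> space_V d"
  by (auto simp: curve_def space_V_def)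

lemma emb_scale_curve: "emb_scale \<phi> c (curve x) = curve (\<phi> c * x)"
  by (simp add: curve_def emb_scale_vec_ab power_mult_distrib inverse_hom_square)

lemma span_curve: "span {curve x} = range (\<lambda>c. curve (\<phi> c * x))"
  by (simp add: span_singleton emb_scale_curve)

lemma point_P_curve: "point_P \<phi> d x (x powi (-2)) = span {curve x}"
  by (simp add: point_P_def curve_def power_int_def)

lemma set_V1_eq: "set_V1 \<phi> d = (\<lambda>x. span {curve x}) ` (UNIV - {0})"
  by (auto simp: set_V1_def point_P_curve)

lemma span_curve_eq_iff:
  assumes "x \<noteq> 0" "y \<noteq> 0"
  shows "span {curve x} = span {curve y} \<longleftrightarrow> (\<exists>c. c \<noteq> 0 \<and> y = \<phi> c * x)"
proof
  assume "span {curve x} = span {curve y}"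
  hence "curve y \<in> range (\<lambda>c. curve (\<phi> c * x))" by (simp add: span_base flip: span_curve)
  then obtain c where "curve y = curve (\<phi> c * x)" by blast
  hence c: "y = \<phi> c * x" by (simp add: curve_eq_iff)
  hence "c \<noteq> 0" using assms(2) hom_0 by auto
  thus "\<exists>c. c \<noteq> 0 \<and> y = \<phi> c * x" using c by blast
next
  assume "\<exists>c. c \<noteq> 0 \<and> y = \<phi> c * x"
  then obtain c where c: "c \<noteq> 0" "y = \<phi> c * x" by blast
  have "\<phi> c * \<phi> (inverse c) = 1" using c(1) by (simp add: hom_1 flip: hom_mult)
  hence x: "x = \<phi> (inverse c) * y" by (simp add: c(2) mult_ac)
  have "curve y = emb_scale \<phi> c (curve x)" "curve x = emb_scale \<phi> (inverse c) (curve y)"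
    using c(2) x by (simp_all only: emb_scale_curve)
  hence "curve y \<in> span {curve x}" "curve x \<in> span {curve y}"
    by (metis insertI1 span_base span_scale)+
  thus "span {curve x} = span {curve y}"
    by (intro equalityI span_minimal subspace_span) auto
qed

text \<open>Equal cubes mean that \<open>y / x\<close> is a cube root of unity, and these are
  exactly the images of the nonzero scalars.\<close>

lemma span_curve_eq_iff_cube:
  assumes "x \<noteq> 0" "y \<noteq> 0"
  shows "span {curve x} = span {curve y} \<longleftrightarrow> x ^ 3 = y ^ 3"
proof -
  have "(\<exists>c. c \<noteq> 0 \<and> y = \<phi> c * x) \<longleftrightarrow> x ^ 3 = y ^ 3"
  proof
    assume "\<exists>c. c \<noteq> 0 \<and> y = \<phi> c * x"
    thus "x ^ 3 = y ^ 3" by (auto simp: power_mult_distrib hom_cube)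
  next
    assume "x ^ 3 = y ^ 3"
    hence "(y / x) ^ 3 = 1" using assms by (simp add: power_divide)
    then obtain c where "c \<noteq> 0" "\<phi> c = y / x" by (rule ex_hom_eq_cube_root)
    thus "\<exists>c. c \<noteq> 0 \<and> y = \<phi> c * x" using assms by auto
  qed
  thus ?thesis by (simp add: span_curve_eq_iff[OF assms])
qed

text \<open>Each point comes from exactly three parameters, the multiples of one of them by the
  three nonzero scalars.\<close>

lemma card_set_V1: "3 * card (set_V1 \<phi> d) = 4 ^ d - 1"
proof -
  let ?F = "UNIV - {0 :: 'a}"
  let ?f = "\<lambda>x. span {curve x}"
  have fib: "card {x \<in> ?F. ?f x = p} = 3" if "p \<in> ?f ` ?F" for p
  proof -
    from that obtain y where y: "y \<noteq> 0" "p = ?f y" by blast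
    have "{x \<in> ?F. ?f x = p} = (\<lambda>c. \<phi> c * y) ` (UNIV - {0})"
    proof (intro set_eqI)
      fix x
      show "x \<in> {x \<in> ?F. ?f x = p} \<longleftrightarrow> x \<in> (\<lambda>c. \<phi> c * y) ` (UNIV - {0})"
      proof (cases "x = 0")
        case True
        thus ?thesis using y(1) by (auto simp: hom_eq_0_iff)
      next
        case False
        have "?f x = p \<longleftrightarrow> (\<exists>c. c \<noteq> 0 \<and> x = \<phi> c * y)"
          using span_curve_eq_iff[OF y(1) False] y(2) by metis
        thus ?thesis using False by blast
      qed
    qed
    moreover have "inj_on (\<lambda>c. \<phi> c * y) (UNIV - {0})"
      using y by (auto intro!: inj_onI simp: hom_inj)
    ultimately show ?thesis by (simp add: card_image card_Diff_subset CARD_base)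
  qed
  have "card ?F = (\<Sum>p\<in>?f ` ?F. card {x \<in> ?F. ?f x = p})"
    using sum.image_gen[of ?F "\<lambda>_. 1::nat" ?f] by simp
  also have "\<dots> = (\<Sum>p\<in>?f ` ?F. 3)" by (rule sum.cong[OF refl]) (rule fib)
  also have "\<dots> = 3 * card (?f ` ?F)" by simp
  finally show ?thesis by (simp add: set_V1_eq CARD_extension card_Diff_subset)
qed

lemma card_set_V1_ge: "card (set_V1 \<phi> d) \<ge> 4"
  using card_set_V1 CARD_extension_ge by (simp add: CARD_extension)

section \<open>No four points of V_1 on a plane\<close>

text \<open>The coefficients of a linear relation are absorbed into the parameters,
  \<open>y x = \<phi> (f (curve x)) * x\<close>. The relation then says that the \<open>y x\<close>
  and the squares of their inverses sum to 0, and the second sum is the square of the sum of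
  inverses. As nonzero scalars have cube 1, the nonzero \<open>y x\<close> still have distinct
  cubes, so all of them vanish.\<close>

lemma independent_curve:
  assumes card: "card X = 4" and X0: "0 \<notin> X" and inj: "inj_on (\<lambda>x. x ^ 3) X"
  shows "independent (curve ` X)"
proof (rule independent_if_scalars_zero)
  have fin: "finite X" using card by (metis card.infinite zero_neq_numeral)
  thus "finite (curve ` X)" by simp
  fix f v assume sum: "(\<Sum>v\<in>curve ` X. emb_scale \<phi> (f v) v) = 0" and v: "v \<in> curve ` X"
  define y where "y x = \<phi> (f (curve x)) * x" for x
  have "inj_on curve X" by (auto intro!: inj_onI simp: curve_eq_iff)
  hence sum': "(\<Sum>x\<in>X. curve (y x)) = 0"
    using sum by (simp add: sum.reindex emb_scale_curve y_def)
  obtain x1 x2 x3 x4 where X: "X = {x1, x2, x3, x4}"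
    and dist: "x1 \<noteq> x2" "x1 \<noteq> x3" "x1 \<noteq> x4" "x2 \<noteq> x3" "x2 \<noteq> x4" "x3 \<noteq> x4"
    using card by (auto simp: card_Suc_eq numeral_eq_Suc)
  have "vec_ab d (y x1 + y x2 + y x3 + y x4)
      ((inverse (y x1))\<^sup>2 + (inverse (y x2))\<^sup>2 + (inverse (y x3))\<^sup>2 + (inverse (y x4))\<^sup>2) = vec_ab d 0 0"
    using sum' dist by (simp add: X curve_def vec_ab_0 vec_ab_add add.assoc)
  hence "y x1 + y x2 + y x3 + y x4 = 0"
    and "(inverse (y x1) + inverse (y x2) + inverse (y x3) + inverse (y x4))\<^sup>2 = 0"
    unfolding vec_ab_eq_iff power2_add_CHAR_2[OF CHAR_extension] by blast+
  moreover have "y u = 0" if "y u ^ 3 = y w ^ 3" "u \<in> X" "w \<in> X" "u \<noteq> w" for u w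
  proof (rule ccontr)
    assume nz: "y u \<noteq> 0"
    hence "y w \<noteq> 0" using that(1) by auto
    hence "f (curve u) \<noteq> 0" "f (curve w) \<noteq> 0" using nz hom_0 by (auto simp: y_def)
    hence "u ^ 3 = w ^ 3" using that(1) by (simp add: y_def power_mult_distrib hom_cube)
    thus False using inj that(2-4) by (auto dest: inj_onD)
  qed
  ultimately have "y x1 = 0 \<and> y x2 = 0 \<and> y x3 = 0 \<and> y x4 = 0"
    using dist by (intro four_sum_eq_0_imp_all_0[OF CHAR_extension]) (auto simp: X)
  hence "y x = 0" if "x \<in> X" for x using that X by auto
  thus "f v = 0" using v X0 by (auto simp: y_def hom_eq_0_iff)
qed

lemma four_points_of_set_V1:
  assumes "T \<subseteq> set_V1 \<phi> d" "card T = 4"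
  obtains X where "T = (\<lambda>x. span {curve x}) ` X" "independent (curve ` X)"
    "card (curve ` X) = 4"
proof -
  from assms(1) obtain X where X: "X \<subseteq> UNIV - {0}" "inj_on (\<lambda>x. span {curve x}) X"
    "T = (\<lambda>x. span {curve x}) ` X"
    unfolding set_V1_eq subset_image_inj by blast
  have card: "card X = 4" using X(2,3) assms(2) by (simp add: card_image)
  have "0 \<notin> X" using X(1) by auto
  have "inj_on (\<lambda>x. x ^ 3) X"
  proof (rule inj_onI)
    fix x y assume xy: "x \<in> X" "y \<in> X" "x ^ 3 = y ^ 3"
    hence "span {curve x} = span {curve y}"
      using span_curve_eq_iff_cube \<open>0 \<notin> X\<close> by metis
    thus "x = y" using xy X(2) by (auto dest: inj_onD)
  qed
  hence "independent (curve ` X)" using independent_curve card \<open>0 \<notin> X\<close> by blast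
  moreover have "card (curve ` X) = 4"
    using card by (subst card_image) (auto intro!: inj_onI simp: curve_eq_iff)
  ultimately show ?thesis using that X(3) by blast
qed

text \<open>Four points of V_1 yield four independent vectors, too many for a space of dimension
  3.\<close>

lemma set_V1_no_four_coplanar:
  assumes "T \<subseteq> set_V1 \<phi> d" "card T = 4" "E \<in> proj_planes (emb_scale \<phi>) (space_V d)"
    "\<forall>p\<in>T. p \<subseteq> E"
  shows False
proof -
  obtain X where X: "T = (\<lambda>x. span {curve x}) ` X" "independent (curve ` X)" "card (curve ` X) = 4"
    using four_points_of_set_V1[OF assms(1,2)] by metis
  obtain B where B: "B \<subseteq> E" "independent B" "E \<subseteq> span B" "card B = dim E"
    using basis_exists .
  have "card B = 3" using B(4) assms(3) by (simp add: proj_planes_def)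
  moreover from this have "finite B" by (metis card.infinite zero_neq_numeral)
  moreover have "curve ` X \<subseteq> span B" using assms(4) X(1) B(3) span_base by blast
  ultimately show False using independent_span_bound X(2,3) by fastforce
qed

section \<open>Spanning and completeness\<close>

text \<open>Write b = c^2. If a c = 1, then v(a, b) is \<open>curve a\<close> and spans a point of
  V_1; otherwise \<open>a\<close> and \<open>c\<close> are simultaneously a sum of three elements
  and of their inverses, and squaring the second sum gives \<open>b\<close>.\<close>

lemma vec_ab_three_sum:
  assumes "(a, b) \<noteq> (0, 0)" "span {vec_ab d a b} \<notin> set_V1 \<phi> d"
  obtains x y z where "x \<noteq> 0" "y \<noteq> 0" "z \<noteq> 0" "vec_ab d a b = curve x + curve y + curve z"
proof -
  obtain c where c: "c\<^sup>2 = b" using square_surj_CHAR_2[OF CHAR_extension] .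
  have "a * c \<noteq> 1"
  proof
    assume "a * c = 1"
    hence "c = inverse a" "a \<noteq> 0" by (auto simp: inverse_unique)
    hence "vec_ab d a b = curve a" using c by (simp add: curve_def)
    thus False using assms(2) \<open>a \<noteq> 0\<close> by (auto simp: set_V1_eq)
  qed
  moreover have "(a, c) \<noteq> (0, 0)" using assms(1) c by auto
  ultimately obtain x y z where *: "x \<noteq> 0" "y \<noteq> 0" "z \<noteq> 0" "x + y + z = a"
    "inverse x + inverse y + inverse z = c"
    using ex_three_sum[OF CHAR_extension CARD_extension_ge] by metis
  have "curve x + curve y + curve z = vec_ab d a b"
    unfolding curve_def vec_ab_add power2_add_CHAR_2[OF CHAR_extension, symmetric] *(4,5) c ..
  thus ?thesis using that *(1-3) by metis
qed

lemma curve_in_span_set_V1: "x \<noteq> 0 \<Longrightarrow> curve x \<in> span (\<Union>(set_V1 \<phi> d))"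
  by (intro span_base UnionI[of "span {curve x}"]) (auto simp: set_V1_eq intro: span_base)

lemma span_set_V1: "span (\<Union>(set_V1 \<phi> d)) = space_V d"
proof
  have "\<Union>(set_V1 \<phi> d) \<subseteq> space_V d"
    using curve_in_space_V by (auto simp: set_V1_eq span_curve)
  thus "span (\<Union>(set_V1 \<phi> d)) \<subseteq> space_V d" by (rule span_minimal) (rule subspace_space_V)
next
  show "space_V d \<subseteq> span (\<Union>(set_V1 \<phi> d))"
  proof
    fix v :: "nat \<Rightarrow> 'a" assume "v \<in> space_V d"
    then obtain a b where v: "v = vec_ab d a b" by (auto simp: space_V_def)
    consider "(a, b) = (0, 0)" | "span {v} \<in> set_V1 \<phi> d"
      | "(a, b) \<noteq> (0, 0)" "span {v} \<notin> set_V1 \<phi> d" by blast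
    thus "v \<in> span (\<Union>(set_V1 \<phi> d))"
    proof cases
      case 1
      thus ?thesis using v vec_ab_0 span_zero by simp
    next
      case 2
      moreover have "v \<in> span {v}" by (simp add: span_base)
      ultimately show ?thesis by (meson UnionI span_base)
    next
      case 3
      then obtain x y z where "x \<noteq> 0" "y \<noteq> 0" "z \<noteq> 0" "v = curve x + curve y + curve z"
        unfolding v by (rule vec_ab_three_sum)
      thus ?thesis by (simp add: span_add curve_in_span_set_V1)
    qed
  qed
qed

lemma four_general_set_V1: "four_general (emb_scale \<phi>) (space_V d) (set_V1 \<phi> d)"
proof -
  have "set_V1 \<phi> d \<subseteq> proj_points (emb_scale \<phi>) (space_V d)"
    by (auto simp: set_V1_eq curve_eq_0_iff curve_in_space_V intro!: span_singleton_in_proj_points)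
  thus ?thesis unfolding four_general_def using span_set_V1 set_V1_no_four_coplanar by blast
qed

text \<open>An additional point is spanned by a sum of three curve vectors, so it lies on every
  plane through the corresponding points of V_1 and forms a coplanar quadruple with three points of
  such a plane.\<close>

lemma set_V1_maximal:
  assumes "four_general (emb_scale \<phi>) (space_V d) S" "set_V1 \<phi> d \<subset> S"
  shows False
proof -
  from assms(2) obtain p where p: "p \<in> S" "p \<notin> set_V1 \<phi> d" by blast
  have "p \<in> proj_points (emb_scale \<phi>) (space_V d)"
    using p(1) assms(1) by (auto simp: four_general_def)
  then obtain a b where ab: "(a, b) \<noteq> (0, 0)" "p = span {vec_ab d a b}"
    by (rule proj_point_eq_span_singleton)
  then obtain x y z where xyz: "x \<noteq> 0" "y \<noteq> 0" "z \<noteq> 0"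
    and v: "vec_ab d a b = curve x + curve y + curve z"
    using vec_ab_three_sum[OF ab(1)] p(2) by metis
  \<comment> \<open>These three points may coincide, so \<open>C0\<close> is enlarged below to a set
    \<open>C\<close> of exactly three points of V_1.\<close>
  define C0 where "C0 = {span {curve x}, span {curve y}, span {curve z}}"
  have "card C0 \<le> 3" by (simp add: C0_def card_insert_if)
  moreover have C0: "C0 \<subseteq> set_V1 \<phi> d" using xyz by (auto simp: C0_def set_V1_eq)
  moreover have fin: "finite (set_V1 \<phi> d)" by (simp add: set_V1_eq)
  ultimately obtain C where C: "C0 \<subseteq> C" "C \<subseteq> set_V1 \<phi> d" "card C = 3"
    using exists_subset_between[of C0 3 "set_V1 \<phi> d"] card_set_V1_ge by auto
  have "finite C" using C(2) fin by (rule finite_subset)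
  \<comment> \<open>A fourth point \<open>r\<close> gives access to the independence of four curve
    vectors; the three that belong to \<open>C\<close> then span a plane.\<close>
  have "\<not> set_V1 \<phi> d \<subseteq> C"
    using card_mono[OF \<open>finite C\<close>, of "set_V1 \<phi> d"] card_set_V1_ge C(3) by auto
  then obtain r where r: "r \<in> set_V1 \<phi> d" "r \<notin> C" by blast
  obtain X where X: "insert r C = (\<lambda>x. span {curve x}) ` X" "independent (curve ` X)"
  proof (rule four_points_of_set_V1)
    show "insert r C \<subseteq> set_V1 \<phi> d" "card (insert r C) = 4"
      using C r \<open>finite C\<close> by auto
  qed
  from X(1) have "C \<subseteq> (\<lambda>x. span {curve x}) ` X" by blast
  then obtain Y where Y: "Y \<subseteq> X" "inj_on (\<lambda>x. span {curve x}) Y" "C = (\<lambda>x. span {curve x}) ` Y"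
    unfolding subset_image_inj by blast
  have cardY: "card (curve ` Y) = 3"
    using Y(2,3) C(3) by (subst card_image) (auto intro!: inj_onI simp: curve_eq_iff card_image)
  define E where "E = span (curve ` Y)"
  have "independent (curve ` Y)" using X(2) Y(1) by (meson independent_mono image_mono)
  hence "dim E = 3" by (simp add: E_def dim_eq_card_independent cardY)
  moreover have "E \<subseteq> space_V d"
    unfolding E_def using curve_in_space_V by (intro span_minimal subspace_space_V) auto
  ultimately have E: "E \<in> proj_planes (emb_scale \<phi>) (space_V d)"
    by (simp add: proj_planes_def E_def)
  have C_E: "q \<subseteq> E" if "q \<in> C" for q
    using that Y(3) unfolding E_def by (auto intro: span_mono[THEN subsetD, rotated])
  have "curve u \<in> E" if "span {curve u} \<in> C0" for u
    using C_E C(1) that span_base by blast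
  hence "vec_ab d a b \<in> E" unfolding v by (auto simp: C0_def E_def intro!: span_add)
  hence "p \<subseteq> E" unfolding ab(2) by (intro span_minimal) (auto simp: E_def)
  hence "\<forall>q\<in>insert p C. q \<subseteq> E" using C_E by blast
  moreover have "insert p C \<subseteq> S" using p(1) C(2) assms(2) by blast
  moreover have "card (insert p C) = 4" using p(2) C \<open>finite C\<close> by (subst card_insert_disjoint) auto
  ultimately show False using E assms(1) unfolding four_general_def by blast
qed

end

theorem theorem4p5:
  fixes \<phi> :: "'k::{field,finite} \<Rightarrow> 'a::{field,finite}" and d :: nat
  assumes "d \<ge> 2"
    and "CARD('a) = 4 ^ d"
    and "CARD('k) = 4"
    and "\<phi> 1 = 1"
    and "\<And>x y. \<phi> (x + y) = \<phi> x + \<phi> y"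
    and "\<And>x y. \<phi> (x * y) = \<phi> x * \<phi> y"
  shows "module.subspace (emb_scale \<phi>) (space_V d)
       \<and> vector_space.dim (emb_scale \<phi>) (space_V d :: (nat \<Rightarrow> 'a) set) = 2 * d
       \<and> (\<forall>a b. (a, b) \<noteq> (0, 0) \<longrightarrow>
            point_P \<phi> d a b \<in> proj_points (emb_scale \<phi>) (space_V d))
       \<and> complete_four_general (emb_scale \<phi>) (space_V d) (set_V1 \<phi> d)
       \<and> real (card (set_V1 \<phi> d)) = (4 ^ d - 1) / 3"
proof -
  interpret gf4_extension \<phi> d by unfold_locales (fact assms)+
  have "point_P \<phi> d a b \<in> proj_points (emb_scale \<phi>) (space_V d)" if "(a, b) \<noteq> (0, 0)" for a b
  proof -
    have "vec_ab d a b \<noteq> 0" using that vec_ab_eq_iff[of a b 0 0] by (simp add: vec_ab_0)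
    with vec_ab_in_space_V show ?thesis
      unfolding point_P_def by (rule span_singleton_in_proj_points)
  qed
  moreover have "complete_four_general (emb_scale \<phi>) (space_V d) (set_V1 \<phi> d)"
    unfolding complete_four_general_def using four_general_set_V1 set_V1_maximal by blast
  moreover have "real (card (set_V1 \<phi> d)) = (4 ^ d - 1) / 3"
  proof -
    have "real (3 * card (set_V1 \<phi> d)) = 4 ^ d - 1" by (simp add: card_set_V1 of_nat_diff)
    thus ?thesis by simp
  qed
  ultimately show ?thesis using subspace_space_V dim_space_V by blast
qed

end
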